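(* The following three statements are equivalent. (A) For every $l\in\mathbb{N}$, every rational dynamical system $(X,\mathcal{T}_1,\ldots,\mathcal{T}_l)$, every $k\in\mathbb{N}$, all real numbers $k_1<k_2$ and every $\varepsilon>0$ there exist $\beta\in\mathbb{Q}\setminus\mathbb{Z}$ and $\gamma\in\mathbb{Z}^\ast$ with $dom^+(\beta)=\emptyset=dom^-(\gamma)$ and $\max dom^-(\beta)<k_1<k_2<\min dom^+(\gamma)$, and $x_0\in X$, such that $\mathcal{T}_i^{p\beta+q\gamma}(x_0)\in B(x_0,\varepsilon)$ for all integers $0\leq p,q\leq k$ and all $1\leq i\leq l$. (B) For every $l\in\mathbb{N}$, every minimal rational dynamical system $(X,\mathcal{T}_1,\ldots,\mathcal{T}_l,R)$ (with $l+1$ families), every $k\in\mathbb{N}$, all real numbers $k_1<k_2$ and every non-empty open set $U\subseteq X$ there exist $\beta\in\mathbb{Q}\setminus\mathbb{Z}$ and $\gamma\in\mathbb{Z}^\ast$ with $dom^+(\beta)=\emptyset=dom^-(\gamma)$ and $\max dom^-(\beta)<k_1<k_2<\min dom^+(\gamma)$ such that $$\bigcap_{0\leq p,q\leq k}\left(U\cap(\mathcal{T}_1^{p\beta+q\gamma})^{-1}U\cap\ldots\cap(\mathcal{T}_l^{p\beta+q\gamma})^{-1}U\right)\neq\emptyset$$ (intersection over integers $p,q$). (C) For every $l\in\mathbb{N}$, every rational dynamical system $(X,\mathcal{T}_1,\ldots,\mathcal{T}_l)$, every $k\in\mathbb{N}$ and all real numbers $k_1<k_2$ there exist $x\in X$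 and sequences $(\beta_n)_{n\in\mathbb{N}}\subseteq\mathbb{Q}\setminus\mathbb{Z}$, $(\gamma_n)_{n\in\mathbb{N}}\subseteq\mathbb{Z}^\ast$ with $dom^+(\beta_n)=\emptyset=dom^-(\gamma_n)$ and $\beta_n+\gamma_n\prec\beta_{n+1}+\gamma_{n+1}$ for every $n\in\mathbb{N}$, and $\max dom^-(\beta_1)<k_1<k_2<\min dom^+(\gamma_1)$, such that, as $n\to\infty$, $\mathcal{T}_i^{p\beta_n+q\gamma_n}(x)\rightarrow x$ for all integers $0\leq p,q\leq k$, simultaneously for all $1\leq i\leq l$.
   Context: Notation: $\mathbb{N}=\{1,2,\ldots\}$, $\mathbb{Z}^\ast=\mathbb{Z}\setminus\{0\}$; $B(x,\varepsilon)$ is the open ball of radius $\varepsilon$ about $x$. Expansion of rationals: every rational number $q$ has a unique expression $q=\sum_{s=1}^{\infty}q_{-s}\frac{(-1)^{s}}{(s+1)!}+\sum_{r=1}^{\infty}q_{r}(-1)^{r+1}r!$ with integers $0\leq q_{-s}\leq s$ for $s\geq 1$ and $0\leq q_r\leq r$ for $r\geq 1$, all but finitely many of which are zero. Put $dom(q)=\{t\in\mathbb{Z}^\ast: q_t\neq 0\}$, $dom^-(q)=\{t\in dom(q): t<0\}$, $dom^+(q)=\{t\in dom(q): t>0\}$. For non-zero rationals $q_1,q_2$, write $q_1\prec q_2$ if and only if $\max dom^-(q_2)<\min dom^-(q_1)<\max dom^+(q_1)<\min dom^+(q_2)$. Rational indexed family: given a family $\{T_n\}_{n\in\mathbb{Z}^\ast}$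 of pairwise commuting continuous maps $X\to X$, for a non-zero rational $q$ with $dom(q)=\{t_1<\ldots<t_m\}$ put $\mathcal{T}^q(x)=T_{t_1}^{q_{t_1}}\cdots T_{t_m}^{q_{t_m}}(x)$, and put $\mathcal{T}^0(x)=x$. Then $\mathcal{T}=(\mathcal{T}^q)_{q\in\mathbb{Q}}$ is the rational indexed family defined from $\{T_n\}_{n\in\mathbb{Z}^\ast}$. Rational dynamical system: $(X,\mathcal{T}_1,\ldots,\mathcal{T}_s)$ where $X$ is a non-empty compact metric space and, for $1\leq i\leq s$, $\mathcal{T}_i$ is the rational indexed family defined from a family $\{T_{i,n}\}_{n\in\mathbb{Z}^\ast}$ of homeomorphisms of $X$ onto itself, such that $T_{i,n_1}T_{j,n_2}=T_{j,n_2}T_{i,n_1}$ for all $1\leq i,j\leq s$ and $n_1,n_2\in\mathbb{Z}^\ast$. It is minimal if every closed $Y\subseteq X$ with $T_{i,n}(Y)=Y$ for all $1\leq i\leq s$, $n\in\mathbb{Z}^\ast$ satisfies $Y=X$ or $Y=\emptyset$. In (B) this is applied with $s=l+1$ and $\mathcal{T}_{l+1}=R$. *)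

theory Defs
  imports "HOL-Analysis.Analysis"
begin

section \<open>The expansion of a rational number\<close>

text \<open>
  The digits are collected in one function on the integers: \<open>c (- int s)\<close> is the coefficient of
  \<open>(-1)^s / (s+1)!\<close> and \<open>c (int r)\<close> the coefficient of \<open>(-1)^(r+1) * r!\<close>.  The index set is the set
  of non-zero integers; the value at 0 is set to 0 so that the digit function is unique.
\<close>

definition is_expansion :: "rat \<Rightarrow> (int \<Rightarrow> nat) \<Rightarrow> bool" where
  "is_expansion q c \<longleftrightarrow>
     c 0 = 0 \<and> finite {t. c t \<noteq> 0} \<and>
     (\<forall>s\<ge>1. c (- int s) \<le> s) \<and> (\<forall>r\<ge>1. c (int r) \<le> r) \<and>
     q = (\<Sum>s | s \<ge> 1 \<and> c (- int s) \<noteq> 0. of_nat (c (- int s)) * ((-1) ^ s / fact (s + 1)))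
       + (\<Sum>r | r \<ge> 1 \<and> c (int r) \<noteq> 0. of_nat (c (int r)) * ((-1) ^ (r + 1) * fact r))"

definition digit :: "rat \<Rightarrow> int \<Rightarrow> nat" where
  "digit q = (THE c. is_expansion q c)"

definition rdom :: "rat \<Rightarrow> int set" where
  "rdom q = {t. t \<noteq> 0 \<and> digit q t \<noteq> 0}"

definition rdom_neg :: "rat \<Rightarrow> int set" where
  "rdom_neg q = {t \<in> rdom q. t < 0}"

definition rdom_pos :: "rat \<Rightarrow> int set" where
  "rdom_pos q = {t \<in> rdom q. t > 0}"

text \<open>
  The four extrema have to exist for the relation to hold; \<open>Max\<close> and \<open>Min\<close> of the empty set are
  unspecified, hence the explicit non-emptiness conditions (which entail that both numbers are
  non-zero).
\<close>

definition rprec :: "rat \<Rightarrow> rat \<Rightarrow> bool" (infix \<open>\<prec>\<^sub>\<rat>\<close> 50) where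
  "q1 \<prec>\<^sub>\<rat> q2 \<longleftrightarrow>
     rdom_neg q1 \<noteq> {} \<and> rdom_pos q1 \<noteq> {} \<and> rdom_neg q2 \<noteq> {} \<and> rdom_pos q2 \<noteq> {} \<and>
     Max (rdom_neg q2) < Min (rdom_neg q1) \<and>
     Min (rdom_neg q1) < Max (rdom_pos q1) \<and>
     Max (rdom_pos q1) < Min (rdom_pos q2)"

definition admissible_pair :: "rat \<Rightarrow> rat \<Rightarrow> bool" where
  "admissible_pair \<beta> \<gamma> \<longleftrightarrow>
     \<beta> \<notin> \<int> \<and> \<gamma> \<in> \<int> \<and> \<gamma> \<noteq> 0 \<and> rdom_pos \<beta> = {} \<and> rdom_neg \<gamma> = {}"

text \<open>
  Only used for admissible pairs, where neither of the two sets below is empty: \<open>\<beta>\<close> is not an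
  integer, so it has a digit at a negative index, and \<open>\<gamma>\<close> is non-zero without such a digit.
\<close>

definition straddles :: "rat \<Rightarrow> rat \<Rightarrow> real \<Rightarrow> real \<Rightarrow> bool" where
  "straddles \<beta> \<gamma> k1 k2 \<longleftrightarrow>
     real_of_int (Max (rdom_neg \<beta>)) < k1 \<and> k1 < k2 \<and> k2 < real_of_int (Min (rdom_pos \<gamma>))"


section \<open>Rational dynamical systems\<close>

text \<open>
  For \<open>rdom q = {t\<^sub>1 < \<dots> < t\<^sub>m}\<close> this is \<open>T t\<^sub>1 ^^ digit q t\<^sub>1 \<circ> \<dots> \<circ> T t\<^sub>m ^^ digit q t\<^sub>m\<close>.
\<close>

definition rational_family :: "(int \<Rightarrow> 'a \<Rightarrow> 'a) \<Rightarrow> rat \<Rightarrow> 'a \<Rightarrow> 'a" where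
  "rational_family T q x = foldr (\<lambda>t. T t ^^ digit q t) (sorted_list_of_set (rdom q)) x"

text \<open>
  \<open>T i n\<close>, for \<open>1 \<le> i \<le> s\<close> and \<open>n \<noteq> 0\<close>, is the \<open>n\<close>-th generator of the \<open>i\<close>-th family.  Other
  values of \<open>T\<close> are irrelevant.
\<close>

locale rational_dynamical_system = Metric_space M d
  for M :: "'a set" and d :: "'a \<Rightarrow> 'a \<Rightarrow> real" +
  fixes s :: nat and T :: "nat \<Rightarrow> int \<Rightarrow> 'a \<Rightarrow> 'a"
  assumes nonempty: "M \<noteq> {}"
    and compact: "compact_space mtopology"
    and homeo: "\<And>i n. i \<in> {1..s} \<Longrightarrow> n \<noteq> 0 \<Longrightarrow> homeomorphic_map mtopology mtopology (T i n)"
    and commute_maps: "\<And>i j m n x. i \<in> {1..s} \<Longrightarrow> j \<in> {1..s} \<Longrightarrow> m \<noteq> 0 \<Longrightarrow> n \<noteq> 0 \<Longrightarrow> x \<in> M \<Longrightarrow>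
          T i m (T j n x) = T j n (T i m x)"

locale minimal_rational_dynamical_system = rational_dynamical_system +
  assumes minimal: "\<And>Y. closedin mtopology Y \<Longrightarrow>
          (\<And>i n. i \<in> {1..s} \<Longrightarrow> n \<noteq> 0 \<Longrightarrow> T i n ` Y = Y) \<Longrightarrow> Y = M \<or> Y = {}"


section \<open>The three recurrence statements\<close>

text \<open>
  HOL cannot quantify over types inside a formula, so each statement quantifies over all systems
  whose underlying set is a subset of a given type \<open>'a\<close>.  This loses nothing: by the following
  lemma, already for \<open>'a = real\<close> every compact metric space occurs up to isometry.
\<close>

lemma compact_metric_space_isometric_real:
  fixes M :: "'a set"
  assumes "Metric_space M d" and "compact_space (Metric_space.mtopology M d)"
  obtains M' :: "real set" and d' f
  where "Metric_space M' d'" and "bij_betw f M M'"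
    and "\<And>x y. x \<in> M \<Longrightarrow> y \<in> M \<Longrightarrow> d' (f x) (f y) = d x y"
proof -
  interpret Metric_space M d by fact
  have "mtotally_bounded M"
    using assms(2) compactin_imp_mtotally_bounded[of M] by (simp add: compact_space_def)
  then have "\<forall>n. \<exists>K. finite K \<and> K \<subseteq> M \<and> M \<subseteq> (\<Union>a\<in>K. mball a (1 / real (Suc n)))"
    unfolding mtotally_bounded_def by simp
  then obtain K where K: "\<And>n. finite (K n)"
      "\<And>n. M \<subseteq> (\<Union>a\<in>K n. mball a (1 / real (Suc n)))"
    by metis
  define D where "D = (\<Union>n. K n) \<times> (UNIV :: nat set)"
  have "countable D"
    using K(1) by (auto simp: D_def intro: countable_finite)
  define g where "g x = {(a, n) \<in> D. d a x < 1 / real (Suc n)}" for x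
  have "inj_on g M"
  proof (rule inj_onI)
    fix x y assume xy: "x \<in> M" "y \<in> M" "g x = g y"
    have "d x y < e" if e: "e > 0" for e
    proof -
      obtain n where n: "1 / real (Suc n) < e / 2"
        using nat_approx_posE[OF half_gt_zero[OF e]] by metis
      obtain a where a: "a \<in> K n" "a \<in> M" "d a x < 1 / real (Suc n)"
        using K(2)[of n] xy(1) by auto
      then have "(a, n) \<in> g x" by (auto simp: g_def D_def)
      then have "d a y < 1 / real (Suc n)" using xy(3) by (auto simp: g_def)
      moreover have "d x y \<le> d a x + d a y"
        using triangle'[of x a y] xy a(2) by (simp add: commute)
      ultimately show ?thesis using a(3) n by linarith
    qed
    then have "d x y \<le> 0" by (meson less_irrefl not_le)
    then show "x = y" using xy by (metis nonneg order_antisym zero)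
  qed
  moreover have "inj_on (image (to_nat_on D)) (Pow D)"
    using \<open>countable D\<close> by (intro inj_on_image_Pow inj_on_to_nat_on)
  moreover have "g ` M \<subseteq> Pow D" by (auto simp: g_def)
  ultimately have "inj_on (image (to_nat_on D) \<circ> g) M"
    by (meson comp_inj_on inj_on_subset)
  moreover obtain h :: "nat set \<Rightarrow> real" where "inj h"
    using nat_sets_eqpoll_reals by (auto simp: eqpoll_def bij_betw_def)
  ultimately have f: "inj_on (h \<circ> (image (to_nat_on D) \<circ> g)) M"
    by (meson comp_inj_on inj_on_subset subset_UNIV)
  define f where "f = h \<circ> (image (to_nat_on D) \<circ> g)"
  define i where "i = inv_into M f"
  have i: "i (f x) = x" if "x \<in> M" for x
    using f that unfolding i_def f_def by (rule inv_into_f_f)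
  show thesis
  proof
    show "Metric_space (f ` M) (\<lambda>u v. d (i u) (i v))"
      by unfold_locales (auto simp: i commute triangle)
    show "bij_betw f M (f ` M)" using f by (simp add: f_def bij_betw_def)
    show "d (i (f x)) (i (f y)) = d x y" if "x \<in> M" "y \<in> M" for x y
      using that by (simp add: i)
  qed
qed

definition recurrence_A :: "'a itself \<Rightarrow> bool" where
  "recurrence_A _ \<longleftrightarrow>
     (\<forall>l\<ge>1. \<forall>(M :: 'a set) d T. rational_dynamical_system M d l T \<longrightarrow>
       (\<forall>k\<ge>1. \<forall>k1 k2 :: real. \<forall>\<epsilon>>0. k1 < k2 \<longrightarrow>
         (\<exists>\<beta> \<gamma>. admissible_pair \<beta> \<gamma> \<and> straddles \<beta> \<gamma> k1 k2 \<and>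
           (\<exists>x0\<in>M. \<forall>p\<le>k. \<forall>q\<le>k. \<forall>i\<in>{1..l}.
              rational_family (T i) (of_nat p * \<beta> + of_nat q * \<gamma>) x0
                \<in> Metric_space.mball M d x0 \<epsilon>))))"

text \<open>The system with the \<open>l + 1\<close> families \<open>T 1, \<dots>, T l, R\<close> is encoded by \<open>T(Suc l := R)\<close>.\<close>

definition recurrence_B :: "'a itself \<Rightarrow> bool" where
  "recurrence_B _ \<longleftrightarrow>
     (\<forall>l\<ge>1. \<forall>(M :: 'a set) d T R.
       minimal_rational_dynamical_system M d (Suc l) (T(Suc l := R)) \<longrightarrow>
       (\<forall>k\<ge>1. \<forall>k1 k2 :: real. \<forall>U. k1 < k2 \<longrightarrow>
         openin (Metric_space.mtopology M d) U \<longrightarrow> U \<noteq> {} \<longrightarrow>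
         (\<exists>\<beta> \<gamma>. admissible_pair \<beta> \<gamma> \<and> straddles \<beta> \<gamma> k1 k2 \<and>
           (\<Inter>p\<in>{..k}. \<Inter>q\<in>{..k}. U \<inter>
              (\<Inter>i\<in>{1..l}.
                 {x \<in> M. rational_family (T i) (of_nat p * \<beta> + of_nat q * \<gamma>) x \<in> U})) \<noteq> {})))"

definition recurrence_C :: "'a itself \<Rightarrow> bool" where
  "recurrence_C _ \<longleftrightarrow>
     (\<forall>l\<ge>1. \<forall>(M :: 'a set) d T. rational_dynamical_system M d l T \<longrightarrow>
       (\<forall>k\<ge>1. \<forall>k1 k2 :: real. k1 < k2 \<longrightarrow>
         (\<exists>x\<in>M. \<exists>\<beta> \<gamma> :: nat \<Rightarrow> rat.
           (\<forall>n\<ge>1. admissible_pair (\<beta> n) (\<gamma> n) \<and>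
                  \<beta> n + \<gamma> n \<prec>\<^sub>\<rat> \<beta> (Suc n) + \<gamma> (Suc n)) \<and>
           straddles (\<beta> 1) (\<gamma> 1) k1 k2 \<and>
           (\<forall>p\<le>k. \<forall>q\<le>k. \<forall>i\<in>{1..l}.
              limitin (Metric_space.mtopology M d)
                (\<lambda>n. rational_family (T i) (of_nat p * \<beta> n + of_nat q * \<gamma> n) x)
                x sequentially))))"

end

theory Submission
  imports Defs
begin

text \<open>
  The implications are proved in the cycle (A), (B), (C), (A).

  From (A) to (B): in a minimal system every orbit under the group generated by the maps meets the
  open set \<open>U\<close>, so by compactness there is \<open>\<epsilon> > 0\<close> such that every \<open>\<epsilon>\<close>-ball is mapped into \<open>U\<close> by a
  single group element \<open>h\<close>. If \<open>x\<close> is \<open>\<epsilon>\<close>-recurrent then, since \<open>h\<close> commutes with the families,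
  \<open>h x\<close> lies in \<open>U\<close> and returns to it.

  From (B) to (C): pass to a minimal subsystem, with the first family repeated in the role of \<open>R\<close>,
  and apply (B) to shrinking balls, each chosen inside the return set of its predecessor and with
  thresholds beyond the digits already used; the point common to all balls is recurrent.

  From (C) to (A): along a \<open>\<prec>\<close>-chain the positive digits of \<open>\<gamma>\<^sub>n\<close> only move up and the negative digits
  of \<open>\<beta>\<^sub>n\<close> only move down, so every \<open>n\<close> satisfies the threshold condition that holds for \<open>n = 1\<close>.
\<close>

section \<open>Factorial-base digits with alternating signs, for integers and for fractions modulo
  1\<close>

section \<open>Existence and uniqueness of digits\<close>

text \<open>The \<open>d r\<close> stand for differences of digits, hence the two-sided bound.
  Starting from the lowest index, all later terms are divisible by \<open>fact (Suc r)\<close>, so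
  \<open>Suc r\<close> divides \<open>d r\<close>, and the bound leaves only 0.\<close>

lemma alternating_factoradic_unique:
  fixes d :: "nat \<Rightarrow> int"
  assumes bound: "\<And>r. \<bar>d r\<bar> \<le> int r"
    and zero: "(\<Sum>r=1..N. d r * ((-1) ^ (r + 1) * fact r)) = 0"
    and "1 \<le> r" "r \<le> N"
  shows "d r = 0"
  using \<open>1 \<le> r\<close> \<open>r \<le> N\<close>
proof (induction r rule: less_induct)
  case (less r)
  have split: "{1..N} = {1..<r} \<union> {r..N}" using less.prems by auto
  define S where "S = (\<Sum>j=Suc r..N. d j * ((-1) ^ (j + 1) * fact j))"
  have "(\<Sum>j=1..N. d j * ((-1) ^ (j + 1) * fact j))
      = (\<Sum>j\<in>{1..<r}. d j * ((-1) ^ (j + 1) * fact j)) + d r * ((-1) ^ (r + 1) * fact r)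
        + S"
    using less.prems unfolding split S_def
    by (simp add: sum.union_disjoint ivl_disj_int sum.atLeast_Suc_atMost[of r N])
  moreover have "(\<Sum>j\<in>{1..<r}. d j * ((-1) ^ (j + 1) * fact j)) = 0"
    using less by (intro sum.neutral) auto
  moreover have "(fact (Suc r) :: int) dvd S"
    unfolding S_def by (intro dvd_sum dvd_mult fact_dvd) auto
  ultimately have "d r * ((-1) ^ (r + 1) * fact r) = - S" "(fact (Suc r) :: int) dvd S"
    using zero by linarith+
  then have "(fact (Suc r) :: int) dvd d r * ((-1) ^ (r + 1) * fact r)"
    by (simp only: dvd_minus_iff)
  then have "fact r * int (Suc r) dvd fact r * (d r * (-1) ^ (r + 1))"
    by (simp add: mult_ac)
  then have "int (Suc r) dvd d r * (-1) ^ (r + 1)"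
    by (subst (asm) dvd_mult_cancel_left) simp
  then have "int (Suc r) dvd d r"
    by (cases "even r") auto
  then show ?case
    using bound[of r] zdvd_imp_le[of "int (Suc r)" "\<bar>d r\<bar>"] by fastforce
qed

text \<open>Here the induction removes the highest index first: multiplying by
  \<open>fact (Suc N)\<close> turns every lower term into an integer and the top term into
  \<open>d (Suc N)\<close> over \<open>N + 2\<close>, up to sign. Integrality of the sum is all that
  enters, so the lemma applies before the integer parts have been compared.\<close>

lemma alternating_factoradic_fraction_unique:
  fixes d :: "nat \<Rightarrow> int"
  assumes bound: "\<And>s. \<bar>d s\<bar> \<le> int s"
    and "(\<Sum>s=1..N. of_int (d s) * ((-1) ^ s / fact (s + 1)) :: rat) \<in> \<int>"
    and "1 \<le> s" "s \<le> N"
  shows "d s = 0"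
  using assms(2-4)
proof (induction N)
  case 0
  then show ?case by simp
next
  case (Suc N)
  define S where "S = (\<Sum>s=1..N. of_int (d s) * ((-1) ^ s / fact (s + 1)) :: rat)"
  have S: "S + of_int (d (Suc N)) * ((-1) ^ Suc N / fact (N + 2)) \<in> \<int>"
    using Suc.prems(1) by (simp add: S_def)
  have "(fact (Suc N) :: rat) / fact (s + 1) \<in> \<int>" if "s \<le> N" for s
    using fact_dvd[of "s + 1" "Suc N", where 'a = int] that
    by (metis Ints_of_int add.commute add_le_cancel_left of_int_divide_in_Ints of_int_fact plus_1_eq_Suc)
  then have "(\<Sum>s=1..N. of_int (d s) * (-1) ^ s * ((fact (Suc N) :: rat) / fact (s + 1))) \<in> \<int>"
    by (intro Ints_sum Ints_mult Ints_power Ints_minus) auto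
  then have S_int: "fact (Suc N) * S \<in> \<int>"
    unfolding S_def sum_distrib_left by (simp add: field_simps)
  have "fact (Suc N) * (S + of_int (d (Suc N)) * ((-1) ^ Suc N / fact (N + 2))) \<in> (\<int> :: rat set)"
    by (intro Ints_mult S) (metis Ints_of_int of_int_fact)
  then have "fact (Suc N) * (S + of_int (d (Suc N)) * ((-1) ^ Suc N / fact (N + 2)))
      - fact (Suc N) * S \<in> (\<int> :: rat set)"
    using S_int by (rule Ints_diff)
  also have "fact (Suc N) * (S + of_int (d (Suc N)) * ((-1) ^ Suc N / fact (N + 2)))
      - fact (Suc N) * S = of_int (d (Suc N) * (-1) ^ Suc N) / of_int (int (N + 2))"
  proof -
    have "(fact (N + 2) :: rat) = of_int (int (N + 2)) * fact (Suc N)" by (simp add: fact_Suc[of "Suc N"])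
    then show ?thesis by (simp add: distrib_left right_diff_distrib del: fact_Suc)
  qed
  finally have "int (N + 2) = 0 \<or> int (N + 2) dvd d (Suc N) * (-1) ^ Suc N"
    by (simp only: of_int_div_of_int_in_Ints_iff)
  then have "int (N + 2) dvd d (Suc N)"
    by (cases "even N") auto
  then have top: "d (Suc N) = 0"
    using bound[of "Suc N"] zdvd_imp_le[of "int (N + 2)" "\<bar>d (Suc N)\<bar>"] by fastforce
  show ?case
  proof (cases "s = Suc N")
    case False
    then show ?thesis using Suc.IH S Suc.prems top by (simp add: S_def)
  qed (use top in simp)
qed

text \<open>
  The digits come from repeated division by \<open>-(r + 1)\<close>; the measure of a negative \<open>m\<close> is one larger
  than that of \<open>-m\<close> because \<open>-1\<close> is sent to \<open>1\<close>.
\<close>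

lemma alternating_factoradic_exists:
  fixes m :: int
  assumes "1 \<le> r"
  shows "\<exists>d N. (\<forall>j. d j \<le> j) \<and> (\<forall>j. j < r \<or> N < j \<longrightarrow> d j = 0) \<and>
    m * ((-1) ^ (r + 1) * fact r) = (\<Sum>j=r..N. int (d j) * ((-1) ^ (j + 1) * fact j))"
  using assms
proof (induction "if m \<ge> 0 then nat (2 * m) else nat (1 - 2 * m)" arbitrary: m r rule: less_induct)
  case less
  show ?case
  proof (cases "m = 0")
    case True
    then show ?thesis by (intro exI[of _ "\<lambda>_. 0"]) auto
  next
    case False
    define b where "b = int (Suc r)"
    \<comment> \<open>The quotient carried to index \<open>r + 1\<close> changes sign, because
      consecutive factorials have opposite signs in the expansion.\<close>
    define m' where "m' = - (m div b)"
    have b: "b \<ge> 2" using less.prems by (simp add: b_def)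
    have m: "m = m mod b - b * m'"
      by (simp add: m'_def)
    have mod: "0 \<le> m mod b" "m mod b < b" using b by auto
    have "(if m' \<ge> 0 then nat (2 * m') else nat (1 - 2 * m')) <
        (if m \<ge> 0 then nat (2 * m) else nat (1 - 2 * m))"
    proof (cases "m > 0")
      case True
      then have "m' \<le> 0" using b by (simp add: m'_def pos_imp_zdiv_nonneg_iff)
      moreover have "- (2 * m') \<le> m"
        using m mod mult_right_mono[OF b, of "- m'"] \<open>m' \<le> 0\<close> by auto
      ultimately show ?thesis using True by (auto simp: not_le)
    next
      case neg: False
      then have "m' > 0" using b False by (simp add: m'_def div_neg_pos_less0)
      \<comment> \<open>The bound \<open>m mod b < b\<close> gives
        \<open>b * (m' - 1) < - m\<close>, which makes \<open>m'\<close> about half of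
        \<open>- m\<close> at most.\<close>
      moreover have "2 * (m' - 1) \<le> b * (m' - 1)"
        using b \<open>m' > 0\<close> by (intro mult_right_mono) auto
      then have "2 * m' \<le> - m + 1"
        using m mod by (simp add: algebra_simps)
      ultimately show ?thesis using neg False by auto
    qed
    from less.hyps[OF this, of "Suc r"] obtain d N where
      d: "\<And>j. d j \<le> j" "\<And>j. j < Suc r \<or> N < j \<Longrightarrow> d j = 0"
      and sum: "m' * ((-1) ^ (Suc r + 1) * fact (Suc r))
        = (\<Sum>j=Suc r..N. int (d j) * ((-1) ^ (j + 1) * fact j))"
      by auto
    define d' where "d' = d(r := nat (m mod b))"
    have "m * ((-1) ^ (r + 1) * fact r)
        = (m mod b) * ((-1) ^ (r + 1) * fact r) + m' * ((-1) ^ (Suc r + 1) * fact (Suc r))"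
      by (subst m) (simp add: b_def algebra_simps)
    also have "m mod b * ((-1) ^ (r + 1) * fact r) + m' * ((-1) ^ (Suc r + 1) * fact (Suc r))
        = (\<Sum>j=r..max r N. int (d' j) * ((-1) ^ (j + 1) * fact j))"
    proof -
      \<comment> \<open>The bound \<open>N\<close> of the induction hypothesis may lie below
        \<open>r\<close>, so the range is extended to \<open>max r N\<close> by zero digits.\<close>
      have "(\<Sum>j=Suc r..N. int (d j) * ((-1) ^ (j + 1) * fact j))
          = (\<Sum>j=Suc r..max r N. int (d' j) * ((-1) ^ (j + 1) * fact j))"
        using d by (intro sum.mono_neutral_cong_left) (auto simp: d'_def)
      then show ?thesis
        unfolding sum using mod by (subst sum.atLeast_Suc_atMost[of r "max r N"]) (auto simp: d'_def)
    qed
    finally have "m * ((-1) ^ (r + 1) * fact r)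
        = (\<Sum>j=r..max r N. int (d' j) * ((-1) ^ (j + 1) * fact j))" .
    moreover have "nat (m mod b) < Suc r"
      by (subst nat_less_iff) (auto simp: b_def)
    ultimately show ?thesis
      using d by (intro exI[of _ d'] exI[of _ "max r N"]) (auto simp: d'_def)
  qed
qed

text \<open>One factor of the denominator is cleared at a time: the digit at \<open>Suc N\<close> is
  chosen so that subtracting its term leaves a number whose product with \<open>fact (N + 1)\<close>
  is already an integer.\<close>

lemma alternating_factoradic_fraction_exists:
  fixes q :: rat
  assumes "q * fact (N + 1) \<in> \<int>"
  shows "\<exists>d. (\<forall>s. d s \<le> s) \<and> (\<forall>s. N < s \<longrightarrow> d s = 0) \<and>
    q - (\<Sum>s=1..N. of_nat (d s) * ((-1) ^ s / fact (s + 1))) \<in> \<int>"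
  using assms
proof (induction N arbitrary: q)
  case 0
  then show ?case by (intro exI[of _ "\<lambda>_. 0"]) auto
next
  case (Suc N)
  from Suc.prems obtain a where a: "q * fact (Suc N + 1) = of_int a"
    by (auto elim: Ints_cases)
  define b where "b = int (N + 2)"
  \<comment> \<open>The sign is its own inverse, so this residue makes
    \<open>a - w * (-1) ^ Suc N\<close> divisible by \<open>b\<close>.\<close>
  define w where "w = (a * (-1) ^ Suc N) mod b"
  define c where "c = nat w"
  have "0 \<le> w" "w < int (N + 2)" by (simp_all add: w_def b_def del: power_Suc)
  then have c: "int c = (a * (-1) ^ Suc N) mod b" "c \<le> Suc N" by (simp_all add: c_def w_def)
  have "b dvd a * (-1) ^ Suc N - int c" unfolding c(1) by (simp add: mod_eq_dvd_iff)
  then have "b dvd (-1) ^ Suc N * (a * (-1) ^ Suc N - int c)" by (rule dvd_mult)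
  also have "(-1) ^ Suc N * (a * (-1) ^ Suc N - int c) = a - int c * (-1) ^ Suc N"
    by (cases "even N") (auto simp: algebra_simps)
  finally obtain e where e: "a - int c * (-1) ^ Suc N = b * e" ..
  define q' where "q' = q - of_nat c * ((-1) ^ Suc N / fact (Suc N + 1))"
  have "q' * fact (Suc N + 1) = of_int (a - int c * (-1) ^ Suc N)"
    unfolding q'_def left_diff_distrib a by simp
  then have "q' * fact (N + 1) * of_int b = of_int e * of_int b"
    unfolding e by (simp add: b_def mult_ac)
  then have "q' * fact (N + 1) = of_int e" by (simp add: b_def del: of_int_of_nat_eq)
  then obtain d where d: "\<And>s. d s \<le> s" "\<And>s. N < s \<Longrightarrow> d s = 0"
    "q' - (\<Sum>s=1..N. of_nat (d s) * ((-1) ^ s / fact (s + 1))) \<in> \<int>"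
    using Suc.IH[of q'] by auto
  have "(\<Sum>s=1..Suc N. of_nat ((d(Suc N := c)) s) * ((-1) ^ s / fact (s + 1)))
      = (\<Sum>s=1..N. of_nat (d s) * ((-1) ^ s / fact (s + 1)))
        + (of_nat c * ((-1) ^ Suc N / fact (Suc N + 1)) :: rat)"
    by (subst sum.cl_ivl_Suc) (auto intro!: sum.cong)
  then have "q - (\<Sum>s=1..Suc N. of_nat ((d(Suc N := c)) s) * ((-1) ^ s / fact (s + 1))) \<in> \<int>"
    using d(3) by (simp add: q'_def algebra_simps)
  then show ?case
    using d c(2) by (intro exI[of _ "d(Suc N := c)"]) auto
qed

section \<open>The two-sided expansion of a rational number\<close>

text \<open>A common bound \<open>N\<close> on the supports replaces the digit-dependent index sets
  by fixed intervals, so that two expansions can be subtracted term by term.\<close>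

lemma is_expansion_bounded_iff:
  assumes "\<And>t. c t \<noteq> 0 \<Longrightarrow> \<bar>t\<bar> \<le> int N"
  shows "is_expansion q c \<longleftrightarrow>
    c 0 = 0 \<and> (\<forall>t. c t \<le> nat \<bar>t\<bar>) \<and>
    q = (\<Sum>s=1..N. of_nat (c (- int s)) * ((-1) ^ s / fact (s + 1)))
      + (\<Sum>r=1..N. of_nat (c (int r)) * ((-1) ^ (r + 1) * fact r))"
proof -
  have "{t. c t \<noteq> 0} \<subseteq> {- int N..int N}"
    using assms by (metis (mono_tags, lifting) CollectD abs_le_iff atLeastAtMost_iff minus_le_iff subsetI)
  then have fin: "finite {t. c t \<noteq> 0}" by (rule finite_subset) simp
  have neg: "s \<le> N" if "c (- int s) \<noteq> 0" for s using assms[OF that] by simp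
  have sum_neg: "(\<Sum>s | s \<ge> 1 \<and> c (- int s) \<noteq> 0. of_nat (c (- int s)) * ((-1) ^ s / fact (s + 1)))
      = (\<Sum>s=1..N. of_nat (c (- int s)) * ((-1) ^ s / fact (s + 1)) :: rat)"
    by (rule sum.mono_neutral_left) (use neg in auto)
  have pos: "r \<le> N" if "c (int r) \<noteq> 0" for r using assms[OF that] by simp
  have sum_pos: "(\<Sum>r | r \<ge> 1 \<and> c (int r) \<noteq> 0. of_nat (c (int r)) * ((-1) ^ (r + 1) * fact r))
      = (\<Sum>r=1..N. of_nat (c (int r)) * ((-1) ^ (r + 1) * fact r) :: rat)"
    by (rule sum.mono_neutral_left) (use pos in auto)
  have bounds: "(\<forall>s\<ge>1. c (- int s) \<le> s) \<and> (\<forall>r\<ge>1. c (int r) \<le> r) \<longleftrightarrow> (\<forall>t. c t \<le> nat \<bar>t\<bar>)"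
    if "c 0 = 0"
  proof
    assume *: "(\<forall>s\<ge>1. c (- int s) \<le> s) \<and> (\<forall>r\<ge>1. c (int r) \<le> r)"
    show "\<forall>t. c t \<le> nat \<bar>t\<bar>"
    proof
      fix t :: int
      consider "t = 0" | "t > 0" | "t < 0" by linarith
      then show "c t \<le> nat \<bar>t\<bar>"
      proof cases
        case 2
        then show ?thesis using conjunct2[OF *, THEN spec[of _ "nat t"]] by simp
      next
        case 3
        then show ?thesis using conjunct1[OF *, THEN spec[of _ "nat (- t)"]] by simp
      qed (use that in simp)
    qed
  next
    assume *: "\<forall>t. c t \<le> nat \<bar>t\<bar>"
    have "c (- int s) \<le> s" "c (int s) \<le> s" for s
      using spec[OF *, of "- int s"] spec[OF *, of "int s"] by simp_all
    then show "(\<forall>s\<ge>1. c (- int s) \<le> s) \<and> (\<forall>r\<ge>1. c (int r) \<le> r)" by blast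
  qed
  show ?thesis unfolding is_expansion_def sum_neg sum_pos using fin bounds by blast
qed

lemma is_expansion_support_bound:
  assumes "is_expansion q c"
  obtains N where "\<And>t. c t \<noteq> 0 \<Longrightarrow> \<bar>t\<bar> \<le> int N"
proof -
  have "finite ((\<lambda>t. nat \<bar>t\<bar>) ` {t. c t \<noteq> 0})" using assms by (auto simp: is_expansion_def)
  then obtain N where "\<forall>n \<in> (\<lambda>t. nat \<bar>t\<bar>) ` {t. c t \<noteq> 0}. n \<le> N"
    using finite_nat_set_iff_bounded_le by blast
  then show ?thesis by (intro that[of N]) (simp add: nat_le_iff)
qed

text \<open>If \<open>b\<close> is the denominator, \<open>fact (b + 1)\<close> clears it, so digits
  at negative indices down to \<open>- b\<close> reduce \<open>q\<close> to an integer. That integer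
  is then expanded in signed factorials from index 1.\<close>

lemma is_expansion_exists: "\<exists>c. is_expansion q c"
proof -
  obtain a b where ab: "q = of_int a / of_int b" "b > 0"
    by (metis quotient_of_div quotient_of_denom_pos surj_pair)
  define K where "K = nat b"
  have "b dvd fact (K + 1)"
    using dvd_fact[of K "K + 1"] ab(2) by (metis K_def One_nat_def Suc_leI add.commute
      le_add2 int_dvd_int_iff nat_0_less_mult_iff nat_eq_iff2 of_nat_fact order_less_imp_le zero_less_nat_eq)
  then obtain e where "fact (K + 1) = b * e" ..
  then have "(fact (K + 1) :: rat) = of_int b * of_int e" by (metis of_int_fact of_int_mult)
  then have "q * fact (K + 1) = of_int (a * e)" using ab by simp
  then obtain u where u: "\<And>s. u s \<le> s" "\<And>s. K < s \<Longrightarrow> u s = 0"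
    "q - (\<Sum>s=1..K. of_nat (u s) * ((-1) ^ s / fact (s + 1))) \<in> \<int>"
    using alternating_factoradic_fraction_exists[of q K] by auto
  then obtain m where m: "q - (\<Sum>s=1..K. of_nat (u s) * ((-1) ^ s / fact (s + 1))) = of_int m"
    by (auto elim: Ints_cases)
  obtain v L where v: "\<And>j. v j \<le> j" "\<And>j. L < j \<Longrightarrow> v j = 0"
    "m = (\<Sum>j=1..L. int (v j) * ((-1) ^ (j + 1) * fact j))"
    using alternating_factoradic_exists[of 1 m] by auto
  define N where "N = max K L"
  define c where "c t = (if t < 0 then u (nat (- t)) else v (nat t))" for t :: int
  have "u 0 = 0" "v 0 = 0" using u(1)[of 0] v(1)[of 0] by auto
  have "q = (\<Sum>s=1..K. of_nat (u s) * ((-1) ^ s / fact (s + 1)))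
      + of_int (\<Sum>j=1..L. int (v j) * ((-1) ^ (j + 1) * fact j))"
    using m unfolding v(3)[symmetric] by simp
  also have "(\<Sum>s=1..K. of_nat (u s) * ((-1) ^ s / fact (s + 1)))
      = (\<Sum>s=1..N. of_nat (c (- int s)) * ((-1) ^ s / fact (s + 1)) :: rat)"
    using u(2) by (intro sum.mono_neutral_cong_left) (auto simp: N_def c_def)
  also have "of_int (\<Sum>j=1..L. int (v j) * ((-1) ^ (j + 1) * fact j))
      = (\<Sum>r=1..L. of_nat (v r) * ((-1) ^ (r + 1) * fact r) :: rat)"
    by simp
  also have "\<dots> = (\<Sum>r=1..N. of_nat (c (int r)) * ((-1) ^ (r + 1) * fact r))"
    using v(2) by (intro sum.mono_neutral_cong_left) (auto simp: N_def c_def)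
  finally have "is_expansion q c"
    using u(1,2) v(1,2) \<open>v 0 = 0\<close>
    by (subst is_expansion_bounded_iff[where N = N])
       (auto simp: c_def N_def not_le split: if_splits intro: leI)
  then show ?thesis by blast
qed

text \<open>The fractional part of the difference of two expansions equals the integer
  \<open>- P\<close>, so the digits at negative indices agree. Then \<open>P = 0\<close>, and the
  remaining digits agree as well.\<close>

lemma is_expansion_unique:
  assumes "is_expansion q c" "is_expansion q c'"
  shows "c = c'"
proof -
  obtain N1 where N1: "\<And>t. c t \<noteq> 0 \<Longrightarrow> \<bar>t\<bar> \<le> int N1"
    using is_expansion_support_bound[OF assms(1)] by blast
  obtain N2 where N2: "\<And>t. c' t \<noteq> 0 \<Longrightarrow> \<bar>t\<bar> \<le> int N2"
    using is_expansion_support_bound[OF assms(2)] by blast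
  define N where "N = max N1 N2"
  have N: "\<bar>t\<bar> \<le> int N" if "c t \<noteq> 0 \<or> c' t \<noteq> 0" for t
    using N1[of t] N2[of t] that by (auto simp: N_def)
  have c: "c 0 = 0" "\<And>t. c t \<le> nat \<bar>t\<bar>"
    and q: "q = (\<Sum>s=1..N. of_nat (c (- int s)) * ((-1) ^ s / fact (s + 1)))
      + (\<Sum>r=1..N. of_nat (c (int r)) * ((-1) ^ (r + 1) * fact r))"
    using assms(1) is_expansion_bounded_iff[of c N q] N by auto
  have c': "c' 0 = 0" "\<And>t. c' t \<le> nat \<bar>t\<bar>"
    and q': "q = (\<Sum>s=1..N. of_nat (c' (- int s)) * ((-1) ^ s / fact (s + 1)))
      + (\<Sum>r=1..N. of_nat (c' (int r)) * ((-1) ^ (r + 1) * fact r))"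
    using assms(2) is_expansion_bounded_iff[of c' N q] N by auto
  define d where "d t = int (c t) - int (c' t)" for t
  have bound: "\<bar>d t\<bar> \<le> \<bar>t\<bar>" for t
    using c(2)[of t] c'(2)[of t] by (auto simp: d_def abs_le_iff)
  define P where "P = (\<Sum>r=1..N. d (int r) * ((-1) ^ (r + 1) * fact r))"
  have diff: "(\<Sum>s=1..N. of_int (d (- int s)) * ((-1) ^ s / fact (s + 1)))
      + (of_int P :: rat) = 0"
    using q' q by (simp only: P_def d_def of_int_sum of_int_mult of_int_diff of_int_power
      of_int_minus of_int_1 of_int_fact of_int_of_nat_eq left_diff_distrib sum_subtractf)
  have neg: "d (- int s) = 0" if "1 \<le> s" "s \<le> N" for s
  proof (rule alternating_factoradic_fraction_unique[of "\<lambda>s. d (- int s)", OF _ _ that])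
    show "\<bar>d (- int s)\<bar> \<le> int s" for s using bound[of "- int s"] by simp
    show "(\<Sum>s=1..N. of_int (d (- int s)) * ((-1) ^ s / fact (s + 1)) :: rat) \<in> \<int>"
      unfolding add_eq_0_iff2[THEN iffD1, OF diff] by simp
  qed
  then have "P = 0" using diff by simp
  then have pos: "d (int r) = 0" if "1 \<le> r" "r \<le> N" for r
    using that bound[of "int _"] by (intro alternating_factoradic_unique[of "\<lambda>r. d (int r)"]) (auto simp: P_def)
  have "d t = 0" for t
  proof (cases "\<bar>t\<bar> \<le> int N \<and> t \<noteq> 0")
    case True
    then show ?thesis
      using pos[of "nat t"] neg[of "nat (- t)"] by (cases "t > 0") auto
  next
    case False
    then have "c t = 0" "c' t = 0" using N[of t] c(1) c'(1) by blast+
    then show ?thesis by (simp add: d_def)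
  qed
  then show ?thesis by (auto simp: d_def fun_eq_iff)
qed

lemma digit_eqI: "is_expansion q c \<Longrightarrow> digit q = c"
  unfolding digit_def by (blast intro: is_expansion_unique)

lemma is_expansion_digit: "is_expansion q (digit q)"
  using is_expansion_exists digit_eqI by metis

section \<open>Index sets of digits and admissible pairs\<close>

lemma finite_rdom [simp]: "finite (rdom_neg q)" "finite (rdom_pos q)"
  using is_expansion_digit[of q]
  unfolding is_expansion_def rdom_neg_def rdom_pos_def rdom_def by auto

lemma rdom_eq_empty_imp_zero:
  assumes "rdom_neg q = {}" "rdom_pos q = {}"
  shows "q = 0"
proof -
  have "digit q t = 0" if "t \<noteq> 0" for t
  proof -
    have "t \<notin> rdom_neg q" "t \<notin> rdom_pos q" using assms by simp_all
    then show ?thesis using that by (auto simp: rdom_neg_def rdom_pos_def rdom_def)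
  qed
  then have empty: "{s. s \<ge> 1 \<and> digit q (- int s) \<noteq> 0} = {}" "{r. r \<ge> 1 \<and> digit q (int r) \<noteq> 0} = {}"
    by auto
  show ?thesis using is_expansion_digit[of q] unfolding is_expansion_def empty by simp
qed

text \<open>The supports are disjoint, so no carrying occurs: the pointwise sum of the digits
  respects the bounds and is therefore the expansion, by uniqueness.\<close>

lemma digit_add:
  assumes "rdom_pos \<beta> = {}" "rdom_neg \<gamma> = {}"
  shows "digit (\<beta> + \<gamma>) t = digit \<beta> t + digit \<gamma> t"
proof -
  have b: "is_expansion \<beta> (digit \<beta>)" and g: "is_expansion \<gamma> (digit \<gamma>)"
    by (rule is_expansion_digit)+
  have zero: "digit \<beta> 0 = 0" "digit \<gamma> 0 = 0"
    using b g by (simp_all add: is_expansion_def)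
  have b0: "digit \<beta> (int r) = 0" for r
  proof -
    have "int r \<notin> rdom_pos \<beta>" using assms(1) by simp
    then show ?thesis using zero by (cases "r = 0") (auto simp: rdom_pos_def rdom_def)
  qed
  have g0: "digit \<gamma> (- int r) = 0" for r
  proof -
    have "- int r \<notin> rdom_neg \<gamma>" using assms(2) by simp
    then show ?thesis using zero by (cases "r = 0") (auto simp: rdom_neg_def rdom_def)
  qed
  have "is_expansion (\<beta> + \<gamma>) (\<lambda>t. digit \<beta> t + digit \<gamma> t)"
    using b g unfolding is_expansion_def by (simp add: b0 g0 Collect_disj_eq)
  from digit_eqI[OF this] show ?thesis by simp
qed

lemma admissible_pair_rdom:
  assumes "admissible_pair \<beta> \<gamma>"
  shows "rdom_neg (\<beta> + \<gamma>) = rdom_neg \<beta>" "rdom_pos (\<beta> + \<gamma>) = rdom_pos \<gamma>"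
    "rdom_neg \<beta> \<noteq> {}" "rdom_pos \<gamma> \<noteq> {}"
proof -
  have e: "rdom_pos \<beta> = {}" "rdom_neg \<gamma> = {}"
    using assms by (auto simp: admissible_pair_def)
  then show "rdom_neg (\<beta> + \<gamma>) = rdom_neg \<beta>" "rdom_pos (\<beta> + \<gamma>) = rdom_pos \<gamma>"
    by (auto simp: rdom_neg_def rdom_pos_def rdom_def digit_add)
  show "rdom_neg \<beta> \<noteq> {}" "rdom_pos \<gamma> \<noteq> {}"
    using assms rdom_eq_empty_imp_zero[of \<beta>] rdom_eq_empty_imp_zero[of \<gamma>] e
    by (auto simp: admissible_pair_def)
qed

section \<open>Composites of generators, the group they generate, and minimal invariant closed
  sets\<close>

section \<open>Generators and minimal subsystems\<close>

text \<open>Every map of the family is a finite composite of generators with non-zero index.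
  Continuity and commutation pass from the generators to the family by this rule, without reference
  to digits.\<close>

lemma rational_family_induct:
  assumes "P id" and "\<And>t f. t \<noteq> 0 \<Longrightarrow> P f \<Longrightarrow> P (T t \<circ> f)"
  shows "P (rational_family T q)"
proof -
  have "P (foldr (\<lambda>t. T t ^^ digit q t) ts)" if "0 \<notin> set ts" for ts
    using that
  proof (induction ts)
    case (Cons t ts)
    have "P (T t ^^ n \<circ> foldr (\<lambda>t. T t ^^ digit q t) ts)" for n
      using Cons assms(2)[of t] by (induction n) (auto simp: comp_assoc)
    then show ?case by (simp add: comp_def)
  qed (use assms(1) in simp)
  moreover have "0 \<notin> set (sorted_list_of_set (rdom q))"
    by (cases "finite (rdom q)") (auto simp: rdom_def)
  ultimately have "P (foldr (\<lambda>t. T t ^^ digit q t) (sorted_list_of_set (rdom q)))"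
    by blast
  then show ?thesis by (simp add: rational_family_def [abs_def])
qed

context rational_dynamical_system
begin

text \<open>Generators are controlled only on \<open>M\<close>, so the inverse is taken as
  \<open>inv_into M\<close>. It agrees on \<open>M\<close> with the inverse of the homeomorphism,
  from which it inherits continuity.\<close>

lemma inverse_generator:
  assumes "i \<in> {1..s}" "n \<noteq> 0"
  shows "continuous_map mtopology mtopology (inv_into M (T i n))"
    and "x \<in> M \<Longrightarrow> inv_into M (T i n) (T i n x) = x"
    and "x \<in> M \<Longrightarrow> T i n (inv_into M (T i n) x) = x"
proof -
  obtain g where g: "homeomorphic_maps mtopology mtopology (T i n) g"
    using homeo[OF assms] homeomorphic_map_maps by blast
  have inj: "inj_on (T i n) M" and surj: "T i n ` M = M"
    using homeo[OF assms] homeomorphic_imp_injective_map homeomorphic_imp_surjective_map by fastforce+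
  then show *: "x \<in> M \<Longrightarrow> inv_into M (T i n) (T i n x) = x"
    and "x \<in> M \<Longrightarrow> T i n (inv_into M (T i n) x) = x" for x
    by (auto simp: f_inv_into_f)
  have eq: "g x = inv_into M (T i n) x" if "x \<in> M" for x
  proof -
    have "g x \<in> M" "T i n (g x) = x"
      using g that by (auto simp: homeomorphic_maps_def continuous_map_def)
    with *[of "g x"] show ?thesis by simp
  qed
  have "continuous_map mtopology mtopology g"
    using g unfolding homeomorphic_maps_def by blast
  then show "continuous_map mtopology mtopology (inv_into M (T i n))"
    by (rule continuous_map_eq) (simp add: eq)
qed

lemma continuous_generator:
  assumes "i \<in> {1..s}" "n \<noteq> 0"
  shows "continuous_map mtopology mtopology (T i n)"
  using homeo[OF assms] homeomorphic_imp_continuous_map by blast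

lemma generator_in_space:
  assumes "i \<in> {1..s}" "n \<noteq> 0" "x \<in> M"
  shows "T i n x \<in> M" "inv_into M (T i n) x \<in> M"
  using continuous_generator[OF assms(1,2)] inverse_generator(1)[OF assms(1,2)] assms(3)
  by (auto simp: continuous_map_def)

lemma continuous_rational_family:
  assumes "i \<in> {1..s}"
  shows "continuous_map mtopology mtopology (rational_family (T i) q)"
  by (rule rational_family_induct)
     (simp, blast intro: continuous_map_compose continuous_generator assms)

inductive_set generated_group :: "('a \<Rightarrow> 'a) set" where
  id: "id \<in> generated_group"
| forward: "h \<in> generated_group \<Longrightarrow> i \<in> {1..s} \<Longrightarrow> n \<noteq> 0 \<Longrightarrow> T i n \<circ> h \<in> generated_group"
| backward: "h \<in> generated_group \<Longrightarrow> i \<in> {1..s} \<Longrightarrow> n \<noteq> 0 \<Longrightarrow>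
    inv_into M (T i n) \<circ> h \<in> generated_group"

lemma continuous_generated_group:
  "h \<in> generated_group \<Longrightarrow> continuous_map mtopology mtopology h"
  by (induction rule: generated_group.induct)
     (simp, (blast intro: continuous_map_compose continuous_generator inverse_generator(1))+)

lemma generated_group_in_space: "h \<in> generated_group \<Longrightarrow> x \<in> M \<Longrightarrow> h x \<in> M"
  using continuous_generated_group[of h] by (auto simp: continuous_map_def)

lemma generated_group_commute:
  assumes "h \<in> generated_group" "i \<in> {1..s}" "n \<noteq> 0" "x \<in> M"
  shows "h (T i n x) = T i n (h x)"
  using assms(1)
proof (induction rule: generated_group.induct)
  case (forward h j m)
  then show ?case
    using assms commute_maps generated_group_in_space by auto
next
  case (backward h j m)
  \<comment> \<open>Writing \<open>h x\<close> as \<open>T j m y\<close> reduces commutation with an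
    inverse to commutation of two generators at \<open>y\<close>.\<close>
  define y where "y = inv_into M (T j m) (h x)"
  have y: "y \<in> M" "T j m y = h x"
    using backward assms generated_group_in_space
    by (simp_all add: y_def generator_in_space inverse_generator)
  then have "inv_into M (T j m) (T i n (h x)) = inv_into M (T j m) (T j m (T i n y))"
    using backward assms commute_maps[of j i m n y] by simp
  also have "\<dots> = T i n y"
    using backward assms y generator_in_space(1) by (simp add: inverse_generator)
  finally show ?case using backward by (simp add: y_def)
qed simp

lemma generated_group_commute_family:
  assumes "h \<in> generated_group" "i \<in> {1..s}" "x \<in> M"
  shows "h (rational_family (T i) q x) = rational_family (T i) q (h x)"
proof -
  \<comment> \<open>Membership in \<open>M\<close> is carried along because the generators are known
    to commute with \<open>h\<close> only there.\<close>
  have "rational_family (T i) q x \<in> M \<and> h (rational_family (T i) q x) = rational_family (T i) q (h x)"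
    by (rule rational_family_induct)
       (use assms in \<open>auto simp: generator_in_space generated_group_commute\<close>)
  then show ?thesis ..
qed

text \<open>Zorn's lemma is applied to the complements: invariant proper open subsets.\<close>

lemma exists_minimal_subsystem:
  obtains Y where "Y \<subseteq> M" "minimal_rational_dynamical_system Y d s T"
proof -
  define invariant where "invariant U \<longleftrightarrow> (\<forall>i\<in>{1..s}. \<forall>n. n \<noteq> 0 \<longrightarrow> T i n ` U = U)" for U
  define \<A> where "\<A> = {U. openin mtopology U \<and> U \<noteq> M \<and> invariant U}"
  have bij: "inj_on (T i n) M" "T i n ` M = M" if "i \<in> {1..s}" "n \<noteq> 0" for i n
    using homeo[OF that] homeomorphic_imp_injective_map homeomorphic_imp_surjective_map by fastforce+
  have invariant_diff: "invariant (M - U)" if "invariant U" "U \<subseteq> M" for U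
    using that bij unfolding invariant_def by (simp add: inj_on_image_set_diff[of _ M])
  have "\<exists>U\<in>\<A>. \<forall>X\<in>\<A>. U \<subseteq> X \<longrightarrow> X = U"
  proof (rule subset_Zorn_nonempty)
    show "\<A> \<noteq> {}" using nonempty by (auto simp: \<A>_def invariant_def)
  next
    fix \<C> assume \<C>: "\<C> \<noteq> {}" "subset.chain \<A> \<C>"
    then have sub: "\<C> \<subseteq> \<A>" by (simp add: subset.chain_def)
    \<comment> \<open>Otherwise compactness yields a finite subchain covering \<open>M\<close>; its
      union is one of its members, yet all members are proper subsets.\<close>
    have "\<Union>\<C> \<noteq> M"
    proof
      assume "\<Union>\<C> = M"
      moreover have "\<forall>U\<in>\<C>. openin mtopology U" using sub by (auto simp: \<A>_def)
      ultimately have "\<exists>\<F>. finite \<F> \<and> \<F> \<subseteq> \<C> \<and> \<Union>\<F> = M"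
        using compact[unfolded compact_space topspace_mtopology, THEN spec[of _ \<C>]] by simp
      then obtain \<F> where \<F>: "finite \<F>" "\<F> \<subseteq> \<C>" "\<Union>\<F> = M" by blast
      have "\<F> \<noteq> {}" using \<F>(3) nonempty by auto
      moreover have "subset.chain \<A> \<F>"
        using \<C>(2) \<F>(2) unfolding subset.chain_def by blast
      ultimately have "\<Union>\<F> \<in> \<F>" using \<F>(1) by (intro Union_in_chain)
      then show False using \<F> sub by (auto simp: \<A>_def)
    qed
    moreover have "openin mtopology (\<Union>\<C>)" using sub by (auto simp: \<A>_def)
    moreover have "invariant (\<Union>\<C>)"
      unfolding invariant_def
    proof (intro ballI allI impI)
      fix i and n :: int assume "i \<in> {1..s}" "n \<noteq> 0"
      moreover have "invariant U" if "U \<in> \<C>" for U using that sub by (auto simp: \<A>_def)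
      ultimately have "T i n ` U = U" if "U \<in> \<C>" for U
        using that by (simp add: invariant_def)
      then show "T i n ` \<Union>\<C> = \<Union>\<C>" by (simp add: image_Union)
    qed
    ultimately show "\<Union>\<C> \<in> \<A>" by (simp add: \<A>_def)
  qed
  then obtain U where U: "openin mtopology U" "U \<noteq> M" "invariant U"
    and max: "\<And>X. X \<in> \<A> \<Longrightarrow> U \<subseteq> X \<Longrightarrow> X = U"
    by (auto simp: \<A>_def)
  have "U \<subseteq> M" using U(1) openin_subset by fastforce
  define Y where "Y = M - U"
  have Y: "Y \<subseteq> M" "Y \<noteq> {}" "closedin mtopology Y" "invariant Y"
    using U \<open>U \<subseteq> M\<close> invariant_diff by (auto simp: Y_def)
  interpret sub: Submetric M d Y by unfold_locales (rule Y)
  have "minimal_rational_dynamical_system Y d s T"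
  proof
    show "Y \<noteq> {}" by (rule Y)
    show "compact_space sub.sub.mtopology"
      unfolding sub.mtopology_submetric
      using compact Y(3) closedin_compact_space compact_space_subtopology by blast
    show "homeomorphic_map sub.sub.mtopology sub.sub.mtopology (T i n)"
      if "i \<in> {1..s}" "n \<noteq> 0" for i n
      unfolding sub.mtopology_submetric
      using Y that by (intro homeomorphic_map_subtopologies homeo) (auto simp: invariant_def Int_absorb1)
    show "T i m (T j n x) = T j n (T i m x)"
      if "i \<in> {1..s}" "j \<in> {1..s}" "m \<noteq> 0" "n \<noteq> 0" "x \<in> Y" for i j m n x
      using that Y(1) commute_maps by blast
  next
    fix Z assume Z: "closedin sub.sub.mtopology Z" "\<And>i n. i \<in> {1..s} \<Longrightarrow> n \<noteq> 0 \<Longrightarrow> T i n ` Z = Z"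
    then have ZM: "closedin mtopology Z" "Z \<subseteq> Y"
      using closedin_closed_subtopology[OF Y(3)] by (simp_all add: sub.mtopology_submetric)
    show "Z = Y \<or> Z = {}"
    proof (cases "Z = {}")
      case False
      \<comment> \<open>The complement of \<open>Z\<close> is an invariant proper open set
        containing \<open>U\<close>, so maximality of \<open>U\<close> forces
        \<open>Z = Y\<close>.\<close>
      then have "M - Z \<in> \<A>"
        using Z(2) ZM Y(1) invariant_diff[of Z] by (auto simp: \<A>_def invariant_def)
      moreover have "U \<subseteq> M - Z" using ZM(2) \<open>U \<subseteq> M\<close> by (auto simp: Y_def)
      ultimately have "M - Z = U" by (rule max)
      then show ?thesis using ZM(2) Y(1) by (auto simp: Y_def)
    qed simp
  qed
  then show thesis using that Y(1) by blast
qed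

end

section \<open>Orbits under the generated group in a minimal system\<close>

section \<open>Minimal systems\<close>

context minimal_rational_dynamical_system
begin

text \<open>The points whose orbit meets \<open>U\<close> form an open set \<open>V\<close> that is
  invariant in both directions. Its complement is closed and invariant, and is not all of
  \<open>M\<close> because \<open>V\<close> contains \<open>U\<close>; minimality makes it
  empty.\<close>

lemma orbit_meets_open:
  assumes "openin mtopology U" "U \<noteq> {}" "x \<in> M"
  obtains h where "h \<in> generated_group" "h x \<in> U"
proof -
  define V where "V = (\<Union>h\<in>generated_group. {x \<in> M. h x \<in> U})"
  have "openin mtopology V"
    unfolding V_def using openin_continuous_map_preimage[OF continuous_generated_group assms(1)]
    by auto
  then have "closedin mtopology (M - V)" by auto
  moreover have "T i n ` (M - V) = M - V" if "i \<in> {1..s}" "n \<noteq> 0" for i n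
  proof -
    have "T i n x \<in> V" if "x \<in> V" for x
    proof -
      from that obtain h where h: "h \<in> generated_group" "x \<in> M" "h x \<in> U" by (auto simp: V_def)
      \<comment> \<open>A group element for \<open>T i n x\<close> arises by cancelling the extra
        generator; its inverse commutes past \<open>h\<close>.\<close>
      have "(inv_into M (T i n) \<circ> h) (T i n x) = h x"
        using h \<open>i \<in> _\<close> \<open>n \<noteq> 0\<close>
        by (simp add: generated_group_commute inverse_generator generated_group_in_space)
      then show ?thesis
        using h generated_group.backward[OF h(1) \<open>i \<in> _\<close> \<open>n \<noteq> 0\<close>]
          generator_in_space(1)[OF \<open>i \<in> _\<close> \<open>n \<noteq> 0\<close> h(2)]
        unfolding V_def by (metis (mono_tags, lifting) UN_I mem_Collect_eq)
    qed
    moreover have "x \<in> V" if "x \<in> M" "T i n x \<in> V" for x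
    proof -
      from that obtain h where h: "h \<in> generated_group" "h (T i n x) \<in> U" by (auto simp: V_def)
      then have "(T i n \<circ> h) x \<in> U"
        using that \<open>i \<in> _\<close> \<open>n \<noteq> 0\<close> by (simp add: generated_group_commute)
      then show ?thesis
        using that generated_group.forward[OF h(1) \<open>i \<in> _\<close> \<open>n \<noteq> 0\<close>] unfolding V_def by blast
    qed
    ultimately have *: "T i n x \<in> V \<longleftrightarrow> x \<in> V" if "x \<in> M" for x using that by blast
    show ?thesis
    proof
      show "T i n ` (M - V) \<subseteq> M - V"
        using * \<open>i \<in> _\<close> \<open>n \<noteq> 0\<close> by (auto simp: generator_in_space)
      show "M - V \<subseteq> T i n ` (M - V)"
      proof
        fix y assume y: "y \<in> M - V"
        define x where "x = inv_into M (T i n) y"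
        have "x \<in> M" "T i n x = y"
          using y that by (simp_all add: x_def generator_in_space inverse_generator)
        then show "y \<in> T i n ` (M - V)" using * y by blast
      qed
    qed
  qed
  ultimately have "M - V = M \<or> M - V = {}" by (rule minimal)
  moreover have "U \<subseteq> V"
  proof
    fix y assume "y \<in> U"
    then have "y \<in> M" "id y \<in> U" using openin_subset[OF assms(1)] by auto
    then show "y \<in> V" unfolding V_def using generated_group.id by blast
  qed
  ultimately have "x \<in> V" using assms openin_subset[OF assms(1)] by auto
  then show thesis using that by (auto simp: V_def)
qed

text \<open>This is a Lebesgue number argument: each point has a ball that one group element maps
  into \<open>U\<close>, and finitely many balls of half the radius cover \<open>M\<close>. With
  \<epsilon> the least of these half radii, every \<epsilon>-ball lies in one of the full
  balls.\<close>

lemma uniform_orbit_meets_open: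
  assumes "openin mtopology U" "U \<noteq> {}"
  obtains \<epsilon> where "\<epsilon> > 0"
    "\<And>x. x \<in> M \<Longrightarrow> \<exists>h\<in>generated_group. \<forall>y\<in>mball x \<epsilon>. h y \<in> U"
proof -
  have "\<exists>h r. h \<in> generated_group \<and> r > 0 \<and> (\<forall>y\<in>mball x (2 * r). h y \<in> U)" if "x \<in> M" for x
  proof -
    obtain h where h: "h \<in> generated_group" "h x \<in> U" by (rule orbit_meets_open[OF assms \<open>x \<in> M\<close>])
    have "openin mtopology {y \<in> M. h y \<in> U}"
      using openin_continuous_map_preimage[OF continuous_generated_group[OF h(1)] assms(1)] by simp
    then obtain r where "r > 0" "mball x r \<subseteq> {y \<in> M. h y \<in> U}"
      using h \<open>x \<in> M\<close> unfolding openin_mtopology by blast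
    then show ?thesis using h by (intro exI[of _ h] exI[of _ "r / 2"]) auto
  qed
  then obtain h r where hr: "\<And>x. x \<in> M \<Longrightarrow> h x \<in> generated_group"
    "\<And>x. x \<in> M \<Longrightarrow> r x > 0" "\<And>x y. x \<in> M \<Longrightarrow> y \<in> mball x (2 * r x) \<Longrightarrow> h x y \<in> U"
    by metis
  have "\<exists>\<F>. finite \<F> \<and> \<F> \<subseteq> (\<lambda>x. mball x (r x)) ` M \<and> M \<subseteq> \<Union>\<F>"
    using compact[unfolded compact_space_alt, rule_format, of "(\<lambda>x. mball x (r x)) ` M"] hr(2) by force
  then obtain \<F> where \<F>: "finite \<F>" "\<F> \<subseteq> (\<lambda>x. mball x (r x)) ` M" "M \<subseteq> \<Union>\<F>" by blast
  obtain F where F: "finite F" "F \<subseteq> M" "M \<subseteq> (\<Union>x\<in>F. mball x (r x))"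
    using finite_subset_image[OF \<F>(1,2)] \<F>(3) by blast
  have "F \<noteq> {}" using F(3) nonempty by auto
  define \<epsilon> where "\<epsilon> = Min (r ` F)"
  have \<epsilon>: "\<epsilon> \<le> r x" if "x \<in> F" for x using F(1) that by (simp add: \<epsilon>_def)
  show thesis
  proof
    show "\<epsilon> > 0" using F hr(2) \<open>F \<noteq> {}\<close> by (auto simp: \<epsilon>_def)
    fix x assume "x \<in> M"
    then obtain z where z: "z \<in> F" "x \<in> mball z (r z)" using F(3) by auto
    have "y \<in> mball z (2 * r z)" if "y \<in> mball x \<epsilon>" for y
      using that z \<epsilon>[OF z(1)] triangle[of z x y] by auto
    then show "\<exists>h\<in>generated_group. \<forall>y\<in>mball x \<epsilon>. h y \<in> U"
      using hr z(1) F(2) by blast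
  qed
qed

end

section \<open>The cycle of implications between the three recurrence statements\<close>

section \<open>Recurrence\<close>

lemma recurrence_A_imp_B:
  assumes A: "recurrence_A TYPE('a)"
  shows "recurrence_B TYPE('a)"
  unfolding recurrence_B_def
proof (intro allI impI)
  fix l and M :: "'a set" and d T R and k :: nat and k1 k2 :: real and U
  assume l: "1 \<le> l" and sys: "minimal_rational_dynamical_system M d (Suc l) (T(Suc l := R))"
    and k: "1 \<le> k" "k1 < k2" and U: "openin (Metric_space.mtopology M d) U" "U \<noteq> {}"
  interpret minimal_rational_dynamical_system M d "Suc l" "T(Suc l := R)" by (rule sys)
  have T: "(T(Suc l := R)) i = T i" "i \<in> {1..Suc l}" if "i \<in> {1..l}" for i using that by auto
  \<comment> \<open>Statement (A) is applied to the first \<open>l\<close> families only, while the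
    group elements used below may also involve \<open>R\<close>, since minimality concerns all
    \<open>l + 1\<close> families.\<close>
  have "rational_dynamical_system M d l T"
  proof
    show "homeomorphic_map mtopology mtopology (T i n)" if "i \<in> {1..l}" "n \<noteq> 0" for i n
      using homeo[of i n] T[OF that(1)] that by simp
    show "T i m (T j n x) = T j n (T i m x)"
      if "i \<in> {1..l}" "j \<in> {1..l}" "m \<noteq> 0" "n \<noteq> 0" "x \<in> M" for i j m n x
      using commute_maps[of i j m n x] T[OF that(1)] T[OF that(2)] that by simp
  qed (fact nonempty compact)+
  note A' = A[unfolded recurrence_A_def, rule_format, OF l this k(1) _ k(2)]
  obtain \<epsilon> where \<epsilon>: "\<epsilon> > 0"
    "\<And>x. x \<in> M \<Longrightarrow> \<exists>h\<in>generated_group. \<forall>y\<in>mball x \<epsilon>. h y \<in> U"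
    using uniform_orbit_meets_open[OF U] by blast
  obtain \<beta> \<gamma> x where bg: "admissible_pair \<beta> \<gamma>" "straddles \<beta> \<gamma> k1 k2" and x: "x \<in> M"
    and ball: "\<And>p q i. p \<le> k \<Longrightarrow> q \<le> k \<Longrightarrow> i \<in> {1..l} \<Longrightarrow>
      rational_family (T i) (of_nat p * \<beta> + of_nat q * \<gamma>) x \<in> mball x \<epsilon>"
    using A'[OF \<epsilon>(1)] by blast
  obtain h where h: "h \<in> generated_group" "\<And>y. y \<in> mball x \<epsilon> \<Longrightarrow> h y \<in> U"
    using \<epsilon>(2)[OF x] by blast
  have "h x \<in> U" using h(2) x \<epsilon>(1) by simp
  \<comment> \<open>By commutation this point is the image under \<open>h\<close> of a point in the
    \<epsilon>-ball about \<open>x\<close>.\<close>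
  moreover have "rational_family (T i) (of_nat p * \<beta> + of_nat q * \<gamma>) (h x) \<in> U"
    if "p \<le> k" "q \<le> k" "i \<in> {1..l}" for p q i
    using generated_group_commute_family[OF h(1) T(2) x, of i] T(1) that h(2)[OF ball[OF that]]
    by simp
  ultimately have "h x \<in> (\<Inter>p\<in>{..k}. \<Inter>q\<in>{..k}. U \<inter>
      (\<Inter>i\<in>{1..l}. {x \<in> M. rational_family (T i) (of_nat p * \<beta> + of_nat q * \<gamma>) x \<in> U}))"
    using generated_group_in_space[OF h(1) x] by blast
  then show "\<exists>\<beta> \<gamma>. admissible_pair \<beta> \<gamma> \<and> straddles \<beta> \<gamma> k1 k2 \<and>
      (\<Inter>p\<in>{..k}. \<Inter>q\<in>{..k}. U \<inter>
        (\<Inter>i\<in>{1..l}. {x \<in> M. rational_family (T i) (of_nat p * \<beta> + of_nat q * \<gamma>) x \<in> U})) \<noteq> {}"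
    using bg by blast
qed


context rational_dynamical_system
begin

text \<open>Statement (B) needs one family more than (C) provides; repeating the first one preserves
  commutation. The index map \<open>j\<close> sends the new index back to 1.\<close>

lemma duplicate_family:
  assumes "1 \<le> s"
  shows "rational_dynamical_system M d (Suc s) (T(Suc s := T 1))"
proof
  define j where "j i = (if i = Suc s then 1 else i)" for i
  have j: "(T(Suc s := T 1)) i = T (j i)" "j i \<in> {1..s}" if "i \<in> {1..Suc s}" for i
    using that assms by (auto simp: j_def)
  show "homeomorphic_map mtopology mtopology ((T(Suc s := T 1)) i n)"
    if "i \<in> {1..Suc s}" "n \<noteq> 0" for i n
    using homeo[OF j(2)] that unfolding j(1)[OF that(1)] by blast
  show "(T(Suc s := T 1)) i m ((T(Suc s := T 1)) i' n x)
      = (T(Suc s := T 1)) i' n ((T(Suc s := T 1)) i m x)"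
    if "i \<in> {1..Suc s}" "i' \<in> {1..Suc s}" "m \<noteq> 0" "n \<noteq> 0" "x \<in> M" for i i' m n x
    using commute_maps[OF j(2) j(2)] that unfolding j(1)[OF that(1)] j(1)[OF that(2)] by blast
qed (fact nonempty compact)+

text \<open>The return set of the ball is open, by continuity of the finitely many maps involved,
  and non-empty by \<open>B\<close>, so it contains a closed ball. Halving the radius makes the
  iterated balls shrink to a point.\<close>

lemma nested_return_step:
  fixes k l :: nat
  assumes B: "\<And>k1 k2 :: real. \<And>U. k1 < k2 \<Longrightarrow> openin mtopology U \<Longrightarrow> U \<noteq> {} \<Longrightarrow>
      \<exists>\<beta> \<gamma>. admissible_pair \<beta> \<gamma> \<and> straddles \<beta> \<gamma> k1 k2 \<and>
        (\<Inter>p\<in>{..k}. \<Inter>q\<in>{..k}. U \<inter>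
          (\<Inter>i\<in>{1..l}. {x \<in> M. rational_family (T i) (of_nat p * \<beta> + of_nat q * \<gamma>) x \<in> U})) \<noteq> {}"
    and l: "1 \<le> l" "l \<le> s" and z: "z \<in> M" "0 < r" and k: "k1 < k2"
  obtains \<beta> \<gamma> z' r' where "admissible_pair \<beta> \<gamma>" "straddles \<beta> \<gamma> k1 k2"
    "z' \<in> M" "0 < r'" "r' \<le> r / 2" "mcball z' r' \<subseteq> mball z r"
    "\<And>x p q i. x \<in> mcball z' r' \<Longrightarrow> p \<le> k \<Longrightarrow> q \<le> k \<Longrightarrow> i \<in> {1..l} \<Longrightarrow>
      rational_family (T i) (of_nat p * \<beta> + of_nat q * \<gamma>) x \<in> mball z r"
proof -
  obtain \<beta> \<gamma> z' where bg: "admissible_pair \<beta> \<gamma>" "straddles \<beta> \<gamma> k1 k2"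
    and z': "z' \<in> (\<Inter>p\<in>{..k}. \<Inter>q\<in>{..k}. mball z r \<inter>
      (\<Inter>i\<in>{1..l}. {x \<in> M. rational_family (T i) (of_nat p * \<beta> + of_nat q * \<gamma>) x \<in> mball z r}))"
    (is "_ \<in> ?V")
    using B[OF k openin_mball[of z r]] z by fastforce
  have "openin mtopology
      (\<Inter>i\<in>{1..l}. {x \<in> M. rational_family (T i) (of_nat p * \<beta> + of_nat q * \<gamma>) x \<in> mball z r})"
    for p q
  \<comment> \<open>The index set must be non-empty, since an empty intersection would be the whole
    type; this is where \<open>1 \<le> l\<close> enters.\<close>
  proof (rule openin_INT2)
    fix i assume "i \<in> {1..l}"
    then have "i \<in> {1..s}" using l by simp
    from openin_continuous_map_preimage[OF continuous_rational_family[OF this] openin_mball]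
    show "openin mtopology
        {x \<in> M. rational_family (T i) (of_nat p * \<beta> + of_nat q * \<gamma>) x \<in> mball z r}"
      by simp
  qed (use l in auto)
  then have "openin mtopology (mball z r \<inter>
      (\<Inter>i\<in>{1..l}. {x \<in> M. rational_family (T i) (of_nat p * \<beta> + of_nat q * \<gamma>) x \<in> mball z r}))"
    for p q
    by (rule openin_Int[OF openin_mball])
  then have "openin mtopology ?V"
    by (intro openin_INT2[of "{..k}"]) simp_all
  then obtain r0 where r0: "r0 > 0" "mcball z' r0 \<subseteq> ?V"
    using z' unfolding openin_mtopology_mcball by blast
  define r' where "r' = min r0 (r / 2)"
  have sub: "mcball z' r' \<subseteq> ?V" using r0(2) by (auto simp: r'_def)
  show thesis
  proof
    show "z' \<in> M" using z' by auto
    show "0 < r'" "r' \<le> r / 2" using r0(1) z(2) by (auto simp: r'_def)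
    show "mcball z' r' \<subseteq> mball z r" using sub by blast
    show "rational_family (T i) (of_nat p * \<beta> + of_nat q * \<gamma>) x \<in> mball z r"
      if "x \<in> mcball z' r'" "p \<le> k" "q \<le> k" "i \<in> {1..l}" for x p q i
      using sub that by blast
  qed (fact bg)+
qed

end

text \<open>The thresholds are the outermost digit positions of the preceding pair. The middle
  inequality of the order comes from the clause \<open>k1 < k2\<close> inside
  \<open>straddles\<close>.\<close>

lemma straddles_next_imp_rprec:
  assumes "admissible_pair \<beta> \<gamma>" "admissible_pair \<beta>' \<gamma>'"
    and "straddles \<beta>' \<gamma>' (of_int (Min (rdom_neg \<beta>))) (of_int (Max (rdom_pos \<gamma>)))"
  shows "\<beta> + \<gamma> \<prec>\<^sub>\<rat> \<beta>' + \<gamma>'"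
  using assms by (simp add: rprec_def straddles_def admissible_pair_rdom)

lemma admissible_pair_Min_less_Max:
  assumes "admissible_pair \<beta> \<gamma>"
  shows "Min (rdom_neg \<beta>) < Max (rdom_pos \<gamma>)"
proof -
  have "Min (rdom_neg \<beta>) \<in> rdom_neg \<beta>" "Max (rdom_pos \<gamma>) \<in> rdom_pos \<gamma>"
    using admissible_pair_rdom[OF assms] by simp_all
  then show ?thesis by (simp add: rdom_neg_def rdom_pos_def)
qed

lemma straddles_rprec_mono:
  assumes "admissible_pair \<beta> \<gamma>" "admissible_pair \<beta>' \<gamma>'"
    and prec: "\<beta> + \<gamma> \<prec>\<^sub>\<rat> \<beta>' + \<gamma>'" and "straddles \<beta> \<gamma> k1 k2"
  shows "straddles \<beta>' \<gamma>' k1 k2"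
proof -
  have "Max (rdom_neg \<beta>') < Min (rdom_neg \<beta>)" "Max (rdom_pos \<gamma>) < Min (rdom_pos \<gamma>')"
    using prec assms(1,2) by (simp_all add: rprec_def admissible_pair_rdom)
  moreover have "Min (rdom_neg \<beta>) \<le> Max (rdom_neg \<beta>)" "Min (rdom_pos \<gamma>) \<le> Max (rdom_pos \<gamma>)"
    using admissible_pair_rdom[OF assms(1)] by simp_all
  ultimately show ?thesis using assms(4) by (auto simp: straddles_def)
qed

lemma recurrence_B_imp_C:
  assumes B: "recurrence_B TYPE('a)"
  shows "recurrence_C TYPE('a)"
  unfolding recurrence_C_def
proof (intro allI impI)
  fix l and M0 :: "'a set" and d T and k :: nat and k1 k2 :: real
  assume l: "1 \<le> l" and sys: "rational_dynamical_system M0 d l T" and k: "1 \<le> k" "k1 < k2"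
  interpret M0: rational_dynamical_system M0 d l T by (rule sys)
  define R where "R = T 1"
  interpret dup: rational_dynamical_system M0 d "Suc l" "T(Suc l := R)"
    unfolding R_def using l by (rule M0.duplicate_family)
  obtain M where M: "M \<subseteq> M0" "minimal_rational_dynamical_system M d (Suc l) (T(Suc l := R))"
    by (rule dup.exists_minimal_subsystem)
  interpret minimal_rational_dynamical_system M d "Suc l" "T(Suc l := R)" by (rule M(2))
  interpret sub: Submetric M0 d M by unfold_locales (rule M(1))
  have T: "(T(Suc l := R)) i = T i" if "i \<in> {1..l}" for i using that by auto
  \<comment> \<open>One step of the construction: the ball of radius \<open>r\<close> about
    \<open>z\<close> and the thresholds \<open>a\<close>, \<open>b\<close> are given, and the primed
    ball and the pair are found.\<close>
  define returns where "returns z r a b z' r' \<beta> \<gamma> \<longleftrightarrow>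
      admissible_pair \<beta> \<gamma> \<and> straddles \<beta> \<gamma> a b \<and> z' \<in> M \<and> 0 < r' \<and> r' \<le> r / 2 \<and>
      mcball z' r' \<subseteq> mball z r \<and>
      (\<forall>x\<in>mcball z' r'. \<forall>p\<le>k. \<forall>q\<le>k. \<forall>i\<in>{1..l}.
        rational_family (T i) (of_nat p * \<beta> + of_nat q * \<gamma>) x \<in> mball z r)"
    for z r a b z' r' \<beta> \<gamma>
  have B': "\<exists>\<beta> \<gamma>. admissible_pair \<beta> \<gamma> \<and> straddles \<beta> \<gamma> a b \<and>
      (\<Inter>p\<in>{..k}. \<Inter>q\<in>{..k}. U \<inter>
        (\<Inter>i\<in>{1..l}. {x \<in> M. rational_family ((T(Suc l := R)) i)
           (of_nat p * \<beta> + of_nat q * \<gamma>) x \<in> U})) \<noteq> {}"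
    if "a < b" "openin mtopology U" "U \<noteq> {}" for a b :: real and U
    using B[unfolded recurrence_B_def, rule_format, OF l M(2) k(1) that]
    by (simp add: T cong: INF_cong_simp)
  have step: "\<exists>z' r' \<beta> \<gamma>. returns z r a b z' r' \<beta> \<gamma>" if zr: "z \<in> M" "0 < r" "a < b" for z r a b
  proof -
    obtain \<beta> \<gamma> z' r' where "admissible_pair \<beta> \<gamma>" "straddles \<beta> \<gamma> a b"
      "z' \<in> M" "0 < r'" "r' \<le> r / 2" "mcball z' r' \<subseteq> mball z r"
      "\<And>x p q i. x \<in> mcball z' r' \<Longrightarrow> p \<le> k \<Longrightarrow> q \<le> k \<Longrightarrow> i \<in> {1..l} \<Longrightarrow>
        rational_family ((T(Suc l := R)) i) (of_nat p * \<beta> + of_nat q * \<gamma>) x \<in> mball z r"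
      by (rule nested_return_step[OF B' l _ zr]) auto
    then have "returns z r a b z' r' \<beta> \<gamma>"
      unfolding returns_def using T by metis
    then show ?thesis by blast
  qed
  \<comment> \<open>A state holds a ball, the thresholds for the next pair, and the pair found on
    reaching the state. The initial state has no such pair and receives the dummy values 0.\<close>
  define start :: "nat \<Rightarrow> 'a \<times> real \<times> real \<times> real \<times> rat \<times> rat \<Rightarrow> bool" where
    "start n = (\<lambda>(z, r, a, b, _). z \<in> M \<and> 0 < r \<and> a < b \<and> (n = 0 \<longrightarrow> r = 1 \<and> a = k1 \<and> b = k2))" for n
  define succ :: "'a \<times> real \<times> real \<times> real \<times> rat \<times> rat \<Rightarrow> 'a \<times> real \<times> real \<times> real \<times> rat \<times> rat \<Rightarrow> bool" where
    "succ = (\<lambda>(z, r, a, b, _) (z', r', a', b', \<beta>, \<gamma>). returns z r a b z' r' \<beta> \<gamma> \<and>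
      a' = of_int (Min (rdom_neg \<beta>)) \<and> b' = of_int (Max (rdom_pos \<gamma>)))"
  have "\<exists>f. \<forall>n. start n (f n) \<and> succ (f n) (f (Suc n))"
  proof (rule dependent_nat_choice)
    obtain z where "z \<in> M" using nonempty by blast
    then have "start 0 (z, 1, k1, k2, 0, 0)" using k(2) by (simp add: start_def)
    then show "\<exists>st. start 0 st" ..
  next
    fix st n assume st: "start n st"
    obtain z r a b c where st_eq: "st = (z, r, a, b, c)" by (metis surj_pair)
    then obtain z' r' \<beta> \<gamma> where ret: "returns z r a b z' r' \<beta> \<gamma>"
      using step st by (fastforce simp: start_def)
    let ?st' = "(z', r', real_of_int (Min (rdom_neg \<beta>)), real_of_int (Max (rdom_pos \<gamma>)), \<beta>, \<gamma>)"
    have "start (Suc n) ?st'" "succ st ?st'"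
      using ret admissible_pair_Min_less_Max[of \<beta> \<gamma>]
      by (simp_all add: start_def succ_def st_eq returns_def)
    then show "\<exists>st'. start (Suc n) st' \<and> succ st st'" by blast
  qed
  then obtain f where f: "\<And>n. start n (f n)" "\<And>n. succ (f n) (f (Suc n))" by blast
  define z where "z n = fst (f n)" for n
  define r where "r n = fst (snd (f n))" for n
  define a where "a n = fst (snd (snd (f n)))" for n
  define b where "b n = fst (snd (snd (snd (f n))))" for n
  define \<beta> where "\<beta> n = fst (snd (snd (snd (snd (f n)))))" for n
  define \<gamma> where "\<gamma> n = snd (snd (snd (snd (snd (f n)))))" for n
  note components = z_def r_def a_def b_def \<beta>_def \<gamma>_def
  have init: "r 0 = 1" "a 0 = k1" "b 0 = k2"
    using f(1)[of 0] by (simp_all add: start_def case_prod_beta components)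
  have z: "z n \<in> M" "0 < r n" for n
    using f(1)[of n] by (simp_all add: start_def case_prod_beta components)
  have ret: "returns (z n) (r n) (a n) (b n) (z (Suc n)) (r (Suc n)) (\<beta> (Suc n)) (\<gamma> (Suc n))"
    and ab: "a (Suc n) = of_int (Min (rdom_neg (\<beta> (Suc n))))"
      "b (Suc n) = of_int (Max (rdom_pos (\<gamma> (Suc n))))" for n
    using f(2)[of n] by (simp_all add: succ_def case_prod_beta components)
  have r_le: "r n \<le> (1 / 2) ^ n" for n
  proof (induction n)
    case (Suc n)
    then show ?case using ret[of n] by (simp add: returns_def)
  qed (simp add: init)
  \<comment> \<open>Compactness of the minimal subsystem gives a point common to the nested closed
    balls; this is the recurrent point.\<close>
  have "(\<Inter>n. mcball (z n) (r n)) \<noteq> {}"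
  proof (rule compact_space_imp_nest[OF compact])
    show "mcball (z n) (r n) \<noteq> {}" for n using z[of n] by (auto simp: mcball_eq_empty)
    show "decseq (\<lambda>n. mcball (z n) (r n))"
    proof (rule decseq_SucI)
      fix n
      have "mcball (z (Suc n)) (r (Suc n)) \<subseteq> mball (z n) (r n)"
        using ret[of n] by (simp add: returns_def)
      then show "mcball (z (Suc n)) (r (Suc n)) \<subseteq> mcball (z n) (r n)"
        using mball_subset_mcball by blast
    qed
  qed simp
  then obtain x where x: "\<And>n. x \<in> mcball (z n) (r n)" by blast
  have "x \<in> M0" using x[of 0] M(1) by auto
  moreover have "admissible_pair (\<beta> (Suc n)) (\<gamma> (Suc n))" for n
    using ret[of n] by (simp add: returns_def)
  then have adm: "admissible_pair (\<beta> n) (\<gamma> n)" if "n \<ge> 1" for n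
    using that by (cases n) auto
  moreover have "\<beta> n + \<gamma> n \<prec>\<^sub>\<rat> \<beta> (Suc n) + \<gamma> (Suc n)" if "n \<ge> 1" for n
  proof (rule straddles_next_imp_rprec)
    show "straddles (\<beta> (Suc n)) (\<gamma> (Suc n)) (of_int (Min (rdom_neg (\<beta> n)))) (of_int (Max (rdom_pos (\<gamma> n))))"
      \<comment> \<open>For positive \<open>n\<close> the thresholds \<open>a n\<close> and
        \<open>b n\<close> are the outermost digit positions of the pair with index
        \<open>n\<close>.\<close>
      using that ret[of n] ab[of "n - 1"] by (simp add: returns_def)
  qed (use adm that in auto)
  moreover have "straddles (\<beta> 1) (\<gamma> 1) k1 k2"
    using ret[of 0] init by (simp add: returns_def)
  moreover have "limitin M0.mtopology
      (\<lambda>n. rational_family (T i) (of_nat p * \<beta> n + of_nat q * \<gamma> n) x) x sequentially"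
    if "p \<le> k" "q \<le> k" "i \<in> {1..l}" for p q i
    unfolding M0.limitin_metric
  proof (intro conjI allI impI \<open>x \<in> M0\<close>)
    fix \<epsilon> :: real assume "\<epsilon> > 0"
    have "(\<lambda>n. 2 * (1 / 2) ^ n :: real) \<longlonglongrightarrow> 2 * 0"
      by (intro tendsto_intros) simp
    then have "\<forall>\<^sub>F n in sequentially. 2 * (1 / 2) ^ n < \<epsilon>"
      using \<open>\<epsilon> > 0\<close> by (simp add: order_tendsto_iff)
    then have "\<forall>\<^sub>F n in sequentially.
        rational_family (T i) (of_nat p * \<beta> (Suc n) + of_nat q * \<gamma> (Suc n)) x \<in> M0 \<and>
        d (rational_family (T i) (of_nat p * \<beta> (Suc n) + of_nat q * \<gamma> (Suc n)) x) x < \<epsilon>"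
    proof eventually_elim
      case (elim n)
      let ?y = "rational_family (T i) (of_nat p * \<beta> (Suc n) + of_nat q * \<gamma> (Suc n)) x"
      \<comment> \<open>Since \<open>x\<close> lies in the ball with index \<open>Suc n\<close>, its
        images under the pair with that index fall into the preceding ball, which also contains
        \<open>x\<close> up to its boundary.\<close>
      have "?y \<in> mball (z n) (r n)"
        using ret[of n] x[of "Suc n"] that unfolding returns_def by blast
      then have "?y \<in> M" "d (z n) ?y < r n" by auto
      moreover have "x \<in> M" "d (z n) x \<le> r n" using x[of n] by auto
      ultimately have "d ?y x < 2 * r n"
        using triangle[of ?y "z n" x] z(1)[of n] by (simp add: commute)
      then show ?case using \<open>?y \<in> M\<close> M(1) elim r_le[of n] by force
    qed
    then show "\<forall>\<^sub>F n in sequentially.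
        rational_family (T i) (of_nat p * \<beta> n + of_nat q * \<gamma> n) x \<in> M0 \<and>
        d (rational_family (T i) (of_nat p * \<beta> n + of_nat q * \<gamma> n) x) x < \<epsilon>"
      by (subst (asm) eventually_sequentially_Suc)
  qed
  ultimately show "\<exists>x\<in>M0. \<exists>\<beta> \<gamma>. (\<forall>n\<ge>1. admissible_pair (\<beta> n) (\<gamma> n) \<and>
        \<beta> n + \<gamma> n \<prec>\<^sub>\<rat> \<beta> (Suc n) + \<gamma> (Suc n)) \<and> straddles (\<beta> 1) (\<gamma> 1) k1 k2 \<and>
      (\<forall>p\<le>k. \<forall>q\<le>k. \<forall>i\<in>{1..l}. limitin M0.mtopology
        (\<lambda>n. rational_family (T i) (of_nat p * \<beta> n + of_nat q * \<gamma> n) x) x sequentially)"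
    by blast
qed

lemma recurrence_C_imp_A:
  assumes C: "recurrence_C TYPE('a)"
  shows "recurrence_A TYPE('a)"
  unfolding recurrence_A_def
proof (intro allI impI)
  fix l and M :: "'a set" and d T and k :: nat and k1 k2 \<epsilon> :: real
  assume l: "1 \<le> l" and sys: "rational_dynamical_system M d l T"
    and k: "1 \<le> k" and \<epsilon>: "0 < \<epsilon>" and k12: "k1 < k2"
  interpret rational_dynamical_system M d l T by (rule sys)
  obtain x \<beta> \<gamma> where x: "x \<in> M"
    and adm: "\<And>n. n \<ge> 1 \<Longrightarrow> admissible_pair (\<beta> n) (\<gamma> n)"
    and prec: "\<And>n. n \<ge> 1 \<Longrightarrow> \<beta> n + \<gamma> n \<prec>\<^sub>\<rat> \<beta> (Suc n) + \<gamma> (Suc n)"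
    and str1: "straddles (\<beta> 1) (\<gamma> 1) k1 k2"
    and lim: "\<And>p q i. p \<le> k \<Longrightarrow> q \<le> k \<Longrightarrow> i \<in> {1..l} \<Longrightarrow> limitin mtopology
      (\<lambda>n. rational_family (T i) (of_nat p * \<beta> n + of_nat q * \<gamma> n) x) x sequentially"
    using C[unfolded recurrence_C_def, rule_format, OF l sys k k12] by blast
  have str: "straddles (\<beta> n) (\<gamma> n) k1 k2" if "n \<ge> 1" for n
    using that
  proof (induction n rule: dec_induct)
    case (step n)
    then show ?case using straddles_rprec_mono adm prec by (metis le_SucI)
  qed (rule str1)
  \<comment> \<open>Only finitely many limits are involved, so a single index \<open>n\<close>
    serves all \<open>p\<close>, \<open>q\<close> and \<open>i\<close>.\<close>
  have "\<forall>\<^sub>F n in sequentially. \<forall>p\<in>{..k}. \<forall>q\<in>{..k}. \<forall>i\<in>{1..l}.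
      rational_family (T i) (of_nat p * \<beta> n + of_nat q * \<gamma> n) x \<in> mball x \<epsilon>"
  proof (intro eventually_ball_finite finite_atMost finite_atLeastAtMost ballI)
    fix p q i assume "p \<in> {..k}" "q \<in> {..k}" "i \<in> {1..l}"
    then have "\<forall>\<^sub>F n in sequentially.
        rational_family (T i) (of_nat p * \<beta> n + of_nat q * \<gamma> n) x \<in> M \<and>
        d (rational_family (T i) (of_nat p * \<beta> n + of_nat q * \<gamma> n) x) x < \<epsilon>"
      using lim[of p q i] \<epsilon> unfolding limitin_metric by auto
    then show "\<forall>\<^sub>F n in sequentially.
        rational_family (T i) (of_nat p * \<beta> n + of_nat q * \<gamma> n) x \<in> mball x \<epsilon>"
      by eventually_elim (use x in \<open>auto simp: commute\<close>)
  qed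
  with eventually_ge_at_top[of 1]
  have "\<forall>\<^sub>F n in sequentially. n \<ge> 1 \<and> (\<forall>p\<in>{..k}. \<forall>q\<in>{..k}. \<forall>i\<in>{1..l}.
      rational_family (T i) (of_nat p * \<beta> n + of_nat q * \<gamma> n) x \<in> mball x \<epsilon>)"
    by (rule eventually_conj)
  then obtain n where "n \<ge> 1" "\<And>p q i. p \<le> k \<Longrightarrow> q \<le> k \<Longrightarrow> i \<in> {1..l} \<Longrightarrow>
      rational_family (T i) (of_nat p * \<beta> n + of_nat q * \<gamma> n) x \<in> mball x \<epsilon>"
    unfolding eventually_sequentially by (metis atMost_iff order_refl)
  then show "\<exists>\<beta> \<gamma>. admissible_pair \<beta> \<gamma> \<and> straddles \<beta> \<gamma> k1 k2 \<and>
      (\<exists>x0\<in>M. \<forall>p\<le>k. \<forall>q\<le>k. \<forall>i\<in>{1..l}.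
        rational_family (T i) (of_nat p * \<beta> + of_nat q * \<gamma>) x0 \<in> mball x0 \<epsilon>)"
    using adm str x by blast
qed

theorem proposition4p4:
  shows "(recurrence_A TYPE('a) \<longleftrightarrow> recurrence_B TYPE('a)) \<and>
         (recurrence_B TYPE('a) \<longleftrightarrow> recurrence_C TYPE('a))"
  using recurrence_A_imp_B recurrence_B_imp_C recurrence_C_imp_A by blast

end
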